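(* Let $A$ be a topological $G$-module such that $H^{1}(G,A/Z(A))=0$ (i.e. it consists of one element). Then there is a bijection between $\bar H^{1}(G,A)$ and $H^{1}(G,A)$. In particular, if $A$ is abelian, then $\bar H^{1}(G,A)\cong H^{1}(G,A)$ (isomorphism of groups).
   Context: Topological groups are not assumed abelian. A topological $G$-module is a topological group $A$ with a continuous left action of the topological group $G$ on $A$ by group automorphisms, written ${}^{g}a$. $Z(A)$ is the center of $A$. For a topological $G$-module $M$, $H^1(G,M)$ is the pointed set of continuous crossed homomorphisms $\alpha:G\to M$ ($\alpha(gh)=\alpha(g)\,{}^{g}\alpha(h)$) modulo $\alpha\sim\beta$ iff there is $m\in M$ with $\beta(g)=m^{-1}\alpha(g)\,{}^{g}m$ for all $g$; it is an abelian group under pointwise multiplication if $M$ is abelian. Put $R=A/Z(A)$, with $G$ acting by ${}^{g}(aZ(A))={}^{g}a\,Z(A)$ and $R$ acting on $A$ by ${}^{aZ(A)}b=aba^{-1}$; let $\pi_A:A\to R$ be the quotient map. Then $\bar H^1(G,A)=H^1(G,(A,\pi_A))$, defined as follows. $Der_{c}(G,(A,\pi_A))$ is the set of pairs $(\alpha,r)$ with $\alpha:G\to A$ a continuous crossed homomorphism and $r\in R$ such that $\pi_A(\alpha(g))=r\,{}^{g}r^{-1}$ for all $g\in G$. With $H^0(G,R)=\{r\in R: {}^{g}r=r\ \forall g\in G\}$, put $(\alpha,r)\sim'(\beta,s)$ if there is $a\in A$ with $\beta(g)=a^{-1}\alpha(g)\,{}^{g}a$ for all $g\in G$ and $s\in\pi_A(a)^{-1}rH^{0}(G,R)$.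 $H^{1}(G,(A,\pi_A))=Der_{c}(G,(A,\pi_A))/\!\sim'$. The product on $Der_c$ is $(\alpha,r)\star(\beta,s)=(\alpha*\beta,rs)$, $(\alpha*\beta)(g)={}^{r}\beta(g)\,\alpha(g)$; when $A$ is abelian it induces the group structure on $\bar H^1(G,A)$. *)

theory Defs
  imports "HOL-Analysis.Abstract_Topology" "HOL-Analysis.Product_Topology" "HOL-Algebra.Coset"
begin

section \<open>Topological groups and topological modules\<close>

locale topological_group = group G for G (structure) +
  fixes T :: "'a topology"
  assumes topspace_eq: "topspace T = carrier G"
    and continuous_mult: "continuous_map (prod_topology T T) T (\<lambda>(x, y). x \<otimes> y)"
    and continuous_inv: "continuous_map T T (\<lambda>x. inv x)"

locale topological_module =
  G: topological_group G TG + A: topological_group A TA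
  for G (structure) and TG and A (structure) and TA +
  fixes act :: "'a \<Rightarrow> 'b \<Rightarrow> 'b"
  assumes act_hom: "g \<in> carrier G \<Longrightarrow> act g \<in> hom A A"
    and act_one: "a \<in> carrier A \<Longrightarrow> act \<one>\<^bsub>G\<^esub> a = a"
    and act_mult: "\<lbrakk>g \<in> carrier G; h \<in> carrier G; a \<in> carrier A\<rbrakk>
      \<Longrightarrow> act (g \<otimes>\<^bsub>G\<^esub> h) a = act g (act h a)"
    and act_continuous: "continuous_map (prod_topology TG TA) TA (\<lambda>(g, a). act g a)"
begin

text \<open>Each \<^term>\<open>act g\<close> is invertible with inverse \<^term>\<open>act (inv\<^bsub>G\<^esub> g)\<close>, so
  requiring homomorphisms is enough to get an action by automorphisms.\<close>

lemma act_iso: assumes g: "g \<in> carrier G" shows "act g \<in> iso A A"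
proof -
  have gi: "inv\<^bsub>G\<^esub> g \<in> carrier G" using g by simp
  have "bij_betw (act g) (carrier A) (carrier A)"
  proof (rule bij_betwI[where g = "act (inv\<^bsub>G\<^esub> g)"])
    show "act g \<in> carrier A \<rightarrow> carrier A" "act (inv\<^bsub>G\<^esub> g) \<in> carrier A \<rightarrow> carrier A"
      using act_hom[OF g] act_hom[OF gi] by (auto simp: hom_def)
    show "act (inv\<^bsub>G\<^esub> g) (act g x) = x" if "x \<in> carrier A" for x
      using act_mult[OF gi g that] act_one[OF that] g by simp
    show "act g (act (inv\<^bsub>G\<^esub> g) x) = x" if "x \<in> carrier A" for x
      using act_mult[OF g gi that] act_one[OF that] g by simp
  qed
  then show ?thesis using act_hom[OF g] by (simp add: iso_def)
qed

end

section \<open>Continuous cohomology in degrees 0 and 1\<close>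

definition H0 :: "('g, 'x) monoid_scheme \<Rightarrow> ('m, 'y) monoid_scheme \<Rightarrow> ('g \<Rightarrow> 'm \<Rightarrow> 'm) \<Rightarrow> 'm set" where
  "H0 G M act = {m \<in> carrier M. \<forall>g\<in>carrier G. act g m = m}"

text \<open>Crossed homomorphisms are taken extensional, so that equality of functions is equality
  on \<^term>\<open>carrier G\<close>.\<close>

definition crossed_homs ::
  "('g, 'x) monoid_scheme \<Rightarrow> 'g topology \<Rightarrow> ('m, 'y) monoid_scheme \<Rightarrow> 'm topology \<Rightarrow>
    ('g \<Rightarrow> 'm \<Rightarrow> 'm) \<Rightarrow> ('g \<Rightarrow> 'm) set" where
  "crossed_homs G TG M TM act = {\<alpha> \<in> carrier G \<rightarrow>\<^sub>E carrier M. continuous_map TG TM \<alpha> \<and>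
    (\<forall>g\<in>carrier G. \<forall>h\<in>carrier G. \<alpha> (g \<otimes>\<^bsub>G\<^esub> h) = \<alpha> g \<otimes>\<^bsub>M\<^esub> act g (\<alpha> h))}"

definition cohomologous ::
  "('g, 'x) monoid_scheme \<Rightarrow> 'g topology \<Rightarrow> ('m, 'y) monoid_scheme \<Rightarrow> 'm topology \<Rightarrow>
    ('g \<Rightarrow> 'm \<Rightarrow> 'm) \<Rightarrow> (('g \<Rightarrow> 'm) \<times> ('g \<Rightarrow> 'm)) set" where
  "cohomologous G TG M TM act =
    {(\<alpha>, \<beta>). \<alpha> \<in> crossed_homs G TG M TM act \<and> \<beta> \<in> crossed_homs G TG M TM act \<and>
      (\<exists>m\<in>carrier M. \<forall>g\<in>carrier G. \<beta> g = inv\<^bsub>M\<^esub> m \<otimes>\<^bsub>M\<^esub> \<alpha> g \<otimes>\<^bsub>M\<^esub> act g m)}"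

definition H1 ::
  "('g, 'x) monoid_scheme \<Rightarrow> 'g topology \<Rightarrow> ('m, 'y) monoid_scheme \<Rightarrow> 'm topology \<Rightarrow>
    ('g \<Rightarrow> 'm \<Rightarrow> 'm) \<Rightarrow> ('g \<Rightarrow> 'm) set set" where
  "H1 G TG M TM act = crossed_homs G TG M TM act // cohomologous G TG M TM act"

text \<open>Products of classes, here and in \<open>barH1_group\<close> below, are unions over all
  representatives of the class of the product; this is the induced operation whenever the product
  of representatives is compatible with the equivalence relation, in particular for abelian
  coefficients.\<close>

definition H1_group ::
  "('g, 'x) monoid_scheme \<Rightarrow> 'g topology \<Rightarrow> ('m, 'y) monoid_scheme \<Rightarrow> 'm topology \<Rightarrow>
    ('g \<Rightarrow> 'm \<Rightarrow> 'm) \<Rightarrow> ('g \<Rightarrow> 'm) set monoid" where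
  "H1_group G TG M TM act =
    \<lparr>carrier = H1 G TG M TM act,
     mult = (\<lambda>X Y. \<Union>\<alpha>\<in>X. \<Union>\<beta>\<in>Y.
       cohomologous G TG M TM act `` {\<lambda>g\<in>carrier G. \<alpha> g \<otimes>\<^bsub>M\<^esub> \<beta> g}),
     one = cohomologous G TG M TM act `` {\<lambda>g\<in>carrier G. \<one>\<^bsub>M\<^esub>}\<rparr>"

section \<open>The quotient by the center\<close>

definition center :: "('a, 'x) monoid_scheme \<Rightarrow> 'a set" where
  "center A = {z \<in> carrier A. \<forall>a\<in>carrier A. z \<otimes>\<^bsub>A\<^esub> a = a \<otimes>\<^bsub>A\<^esub> z}"

lemma (in group) center_subgroup: "subgroup (center G) G"
proof (rule subgroupI)
  show "center G \<subseteq> carrier G" "center G \<noteq> {}" by (auto simp: center_def)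
next
  fix z assume z: "z \<in> center G"
  then have zc: "z \<in> carrier G" by (simp add: center_def)
  have "inv z \<otimes> a = a \<otimes> inv z" if a: "a \<in> carrier G" for a
  proof -
    have "inv z \<otimes> a = inv (inv a \<otimes> z)" using a zc by (simp add: inv_mult_group)
    also have "inv a \<otimes> z = z \<otimes> inv a" using z a by (simp add: center_def)
    finally show ?thesis using a zc by (simp add: inv_mult_group)
  qed
  then show "inv z \<in> center G" using zc by (simp add: center_def)
next
  fix y z assume y: "y \<in> center G" and z: "z \<in> center G"
  then have c: "y \<in> carrier G" "z \<in> carrier G" by (auto simp: center_def)
  have "y \<otimes> z \<otimes> a = a \<otimes> (y \<otimes> z)" if a: "a \<in> carrier G" for a
  proof -
    have "y \<otimes> z \<otimes> a = y \<otimes> (a \<otimes> z)" using z a c by (simp add: center_def m_assoc)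
    also have "\<dots> = y \<otimes> a \<otimes> z" using a c by (simp add: m_assoc)
    also have "y \<otimes> a = a \<otimes> y" using y a by (simp add: center_def)
    finally show ?thesis using a c by (simp add: m_assoc)
  qed
  then show "y \<otimes> z \<in> center G" using c by (simp add: center_def)
qed

lemma (in group) center_normal: "center G \<lhd> G"
  unfolding normal_inv_iff
proof (intro conjI center_subgroup ballI)
  fix x h assume x: "x \<in> carrier G" and h: "h \<in> center G"
  then have hc: "h \<in> carrier G" and "x \<otimes> h = h \<otimes> x" by (auto simp: center_def)
  then have "x \<otimes> h \<otimes> inv x = h" using x by (simp add: m_assoc)
  then show "x \<otimes> h \<otimes> inv x \<in> center G" using h by simp
qed

text \<open>Since the center is normal, the right cosets \<open>center A #>\<^bsub>A\<^esub> a\<close>, of which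
  \<open>A Mod center A\<close> consists, are the left cosets \<open>a Z(A)\<close>.\<close>

abbreviation central_quotient :: "('a, 'x) monoid_scheme \<Rightarrow> 'a set monoid" where
  "central_quotient A \<equiv> A Mod center A"

definition central_proj :: "('a, 'x) monoid_scheme \<Rightarrow> 'a \<Rightarrow> 'a set" where
  "central_proj A a = center A #>\<^bsub>A\<^esub> a"

definition central_quotient_topology ::
  "('a, 'x) monoid_scheme \<Rightarrow> 'a topology \<Rightarrow> 'a set topology" where
  "central_quotient_topology A TA = topology (\<lambda>U. U \<subseteq> carrier (central_quotient A) \<and>
    openin TA {a \<in> carrier A. central_proj A a \<in> U})"

lemma (in topological_group) openin_central_quotient_topology:
  "openin (central_quotient_topology G T) U \<longleftrightarrow>
    U \<subseteq> carrier (central_quotient G) \<and> openin T {a \<in> carrier G. central_proj G a \<in> U}"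
proof -
  have "istopology (\<lambda>U. U \<subseteq> carrier (central_quotient G) \<and>
    openin T {a \<in> carrier G. central_proj G a \<in> U})" (is "istopology ?P")
    unfolding istopology_def
  proof (intro conjI allI impI)
    fix S U assume "?P S" "?P U"
    moreover have "{a \<in> carrier G. central_proj G a \<in> S \<inter> U} =
      {a \<in> carrier G. central_proj G a \<in> S} \<inter> {a \<in> carrier G. central_proj G a \<in> U}" by auto
    ultimately show "S \<inter> U \<subseteq> carrier (central_quotient G)"
      "openin T {a \<in> carrier G. central_proj G a \<in> S \<inter> U}" by auto
  next
    fix K assume K: "\<forall>S\<in>K. ?P S"
    then show "\<Union>K \<subseteq> carrier (central_quotient G)" by blast
    have "{a \<in> carrier G. central_proj G a \<in> \<Union>K} =
      (\<Union>S\<in>K. {a \<in> carrier G. central_proj G a \<in> S})" by auto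
    then show "openin T {a \<in> carrier G. central_proj G a \<in> \<Union>K}" using K by auto
  qed
  then show ?thesis by (simp add: central_quotient_topology_def topology_inverse')
qed

lemma (in topological_group) quotient_map_central_proj:
  "quotient_map T (central_quotient_topology G T) (central_proj G)"
proof -
  have img: "central_proj G ` carrier G = carrier (central_quotient G)"
    by (auto simp: FactGroup_def RCOSETS_def central_proj_def)
  have "{a \<in> carrier G. central_proj G a \<in> carrier (central_quotient G)} = carrier G"
    using img by auto
  then have "openin (central_quotient_topology G T) (carrier (central_quotient G))"
    unfolding openin_central_quotient_topology
    by (metis openin_topspace order_refl topspace_eq)
  then have "topspace (central_quotient_topology G T) = carrier (central_quotient G)"
    by (meson openin_central_quotient_topology openin_subset openin_topspace subset_antisym)
  then show ?thesis
    by (simp add: quotient_map_def topspace_eq img openin_central_quotient_topology)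
qed

text \<open>The actions of \<open>G\<close> on \<open>A/Z(A)\<close> and of \<open>A/Z(A)\<close> on \<open>A\<close>, as functions of a coset.
  The two lemmas after them are the defining equations on representatives.\<close>

definition central_quotient_act ::
  "('a, 'x) monoid_scheme \<Rightarrow> ('g \<Rightarrow> 'a \<Rightarrow> 'a) \<Rightarrow> 'g \<Rightarrow> 'a set \<Rightarrow> 'a set" where
  "central_quotient_act A act g r = (\<Union>a\<in>r. central_proj A (act g a))"

definition central_conj :: "('a, 'x) monoid_scheme \<Rightarrow> 'a set \<Rightarrow> 'a \<Rightarrow> 'a" where
  "central_conj A r b = (THE c. \<exists>a\<in>r. c = a \<otimes>\<^bsub>A\<^esub> b \<otimes>\<^bsub>A\<^esub> inv\<^bsub>A\<^esub> a)"

lemma (in topological_module) central_quotient_act_proj: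
  assumes g: "g \<in> carrier G" and a: "a \<in> carrier A"
  shows "central_quotient_act A act g (central_proj A a) = central_proj A (act g a)"
proof -
  interpret h: group_hom A A "act g"
    by (rule group_hom.intro[OF A.is_group A.is_group])
      (simp add: group_hom_axioms_def act_hom[OF g])
  have surj: "act g ` carrier A = carrier A"
    using act_iso[OF g] by (auto simp: iso_def bij_betw_def)
  have c: "act g z \<in> center A" if "z \<in> center A" for z
  proof -
    have zc: "z \<in> carrier A" using that by (simp add: center_def)
    have "act g z \<otimes>\<^bsub>A\<^esub> b = b \<otimes>\<^bsub>A\<^esub> act g z" if b: "b \<in> carrier A" for b
    proof -
      from b surj have "b \<in> act g ` carrier A" by simp
      then obtain d where d: "d \<in> carrier A" and bd: "b = act g d" by (elim imageE)
      have "act g z \<otimes>\<^bsub>A\<^esub> act g d = act g (z \<otimes>\<^bsub>A\<^esub> d)" using h.hom_mult[OF zc d] by simp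
      also have "z \<otimes>\<^bsub>A\<^esub> d = d \<otimes>\<^bsub>A\<^esub> z" using \<open>z \<in> center A\<close> d by (simp add: center_def)
      also have "act g (d \<otimes>\<^bsub>A\<^esub> z) = act g d \<otimes>\<^bsub>A\<^esub> act g z" using h.hom_mult[OF d zc] .
      finally show ?thesis by (simp only: bd)
    qed
    then show ?thesis using h.hom_closed[OF zc] by (simp add: center_def)
  qed
  have "central_proj A (act g x) = central_proj A (act g a)" if x: "x \<in> central_proj A a" for x
  proof -
    obtain z where z: "z \<in> center A" "x = z \<otimes>\<^bsub>A\<^esub> a"
      using x by (auto simp: central_proj_def r_coset_def)
    have "act g x = act g z \<otimes>\<^bsub>A\<^esub> act g a" using z a h.hom_mult[of z a] by (simp add: center_def)
    then have "act g x \<in> center A #>\<^bsub>A\<^esub> act g a" using c[OF z(1)] by (auto simp: r_coset_def)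
    from A.repr_independence[OF this h.hom_closed[OF a] A.center_subgroup]
    show ?thesis by (simp add: central_proj_def)
  qed
  moreover have "a \<in> central_proj A a"
    unfolding central_proj_def using A.rcos_self[OF a A.center_subgroup] .
  ultimately show ?thesis unfolding central_quotient_act_def by blast
qed

lemma (in group) central_conj_proj:
  assumes a: "a \<in> carrier G" and b: "b \<in> carrier G"
  shows "central_conj G (central_proj G a) b = a \<otimes> b \<otimes> inv a"
  unfolding central_conj_def
proof (rule the_equality)
  show "\<exists>x\<in>central_proj G a. a \<otimes> b \<otimes> inv a = x \<otimes> b \<otimes> inv x"
    unfolding central_proj_def using rcos_self[OF a center_subgroup] by blast
  fix c assume "\<exists>x\<in>central_proj G a. c = x \<otimes> b \<otimes> inv x"
  then obtain z where z: "z \<in> center G" and c: "c = (z \<otimes> a) \<otimes> b \<otimes> inv (z \<otimes> a)"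
    by (auto simp: central_proj_def r_coset_def)
  have zc: "z \<in> carrier G" using z by (simp add: center_def)
  have "c = z \<otimes> (a \<otimes> b \<otimes> inv a) \<otimes> inv z"
    using a b zc by (simp add: c inv_mult_group m_assoc)
  also have "z \<otimes> (a \<otimes> b \<otimes> inv a) = (a \<otimes> b \<otimes> inv a) \<otimes> z"
    using z a b by (simp add: center_def)
  finally show "c = a \<otimes> b \<otimes> inv a" using a b zc by (simp add: m_assoc)
qed

section \<open>The cohomology of \<open>G\<close> with coefficients in \<open>A \<rightarrow> A/Z(A)\<close>\<close>

definition Der_c ::
  "('g, 'x) monoid_scheme \<Rightarrow> 'g topology \<Rightarrow> ('a, 'y) monoid_scheme \<Rightarrow> 'a topology \<Rightarrow>
    ('g \<Rightarrow> 'a \<Rightarrow> 'a) \<Rightarrow> (('g \<Rightarrow> 'a) \<times> 'a set) set" where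
  "Der_c G TG A TA act =
    {(\<alpha>, r). \<alpha> \<in> crossed_homs G TG A TA act \<and> r \<in> carrier (central_quotient A) \<and>
      (\<forall>g\<in>carrier G. central_proj A (\<alpha> g) =
        r \<otimes>\<^bsub>central_quotient A\<^esub> central_quotient_act A act g (inv\<^bsub>central_quotient A\<^esub> r))}"

definition Der_c_rel ::
  "('g, 'x) monoid_scheme \<Rightarrow> 'g topology \<Rightarrow> ('a, 'y) monoid_scheme \<Rightarrow> 'a topology \<Rightarrow>
    ('g \<Rightarrow> 'a \<Rightarrow> 'a) \<Rightarrow> ((('g \<Rightarrow> 'a) \<times> 'a set) \<times> (('g \<Rightarrow> 'a) \<times> 'a set)) set" where
  "Der_c_rel G TG A TA act =
    {((\<alpha>, r), (\<beta>, s)). (\<alpha>, r) \<in> Der_c G TG A TA act \<and> (\<beta>, s) \<in> Der_c G TG A TA act \<and>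
      (\<exists>a\<in>carrier A.
        (\<forall>g\<in>carrier G. \<beta> g = inv\<^bsub>A\<^esub> a \<otimes>\<^bsub>A\<^esub> \<alpha> g \<otimes>\<^bsub>A\<^esub> act g a) \<and>
        s \<in> (inv\<^bsub>central_quotient A\<^esub> (central_proj A a) \<otimes>\<^bsub>central_quotient A\<^esub> r)
              <#\<^bsub>central_quotient A\<^esub> H0 G (central_quotient A) (central_quotient_act A act))}"

definition Der_c_mult ::
  "('g, 'x) monoid_scheme \<Rightarrow> ('a, 'y) monoid_scheme \<Rightarrow>
    ('g \<Rightarrow> 'a) \<times> 'a set \<Rightarrow> ('g \<Rightarrow> 'a) \<times> 'a set \<Rightarrow> ('g \<Rightarrow> 'a) \<times> 'a set" where
  "Der_c_mult G A = (\<lambda>(\<alpha>, r) (\<beta>, s).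
    (\<lambda>g\<in>carrier G. central_conj A r (\<beta> g) \<otimes>\<^bsub>A\<^esub> \<alpha> g, r \<otimes>\<^bsub>central_quotient A\<^esub> s))"

definition barH1 ::
  "('g, 'x) monoid_scheme \<Rightarrow> 'g topology \<Rightarrow> ('a, 'y) monoid_scheme \<Rightarrow> 'a topology \<Rightarrow>
    ('g \<Rightarrow> 'a \<Rightarrow> 'a) \<Rightarrow> (('g \<Rightarrow> 'a) \<times> 'a set) set set" where
  "barH1 G TG A TA act = Der_c G TG A TA act // Der_c_rel G TG A TA act"

definition barH1_group ::
  "('g, 'x) monoid_scheme \<Rightarrow> 'g topology \<Rightarrow> ('a, 'y) monoid_scheme \<Rightarrow> 'a topology \<Rightarrow>
    ('g \<Rightarrow> 'a \<Rightarrow> 'a) \<Rightarrow> (('g \<Rightarrow> 'a) \<times> 'a set) set monoid" where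
  "barH1_group G TG A TA act =
    \<lparr>carrier = barH1 G TG A TA act,
     mult = (\<lambda>X Y. \<Union>x\<in>X. \<Union>y\<in>Y. Der_c_rel G TG A TA act `` {Der_c_mult G A x y}),
     one = Der_c_rel G TG A TA act ``
       {(\<lambda>g\<in>carrier G. \<one>\<^bsub>A\<^esub>, \<one>\<^bsub>central_quotient A\<^esub>)}\<rparr>"

end

theory Submission
  imports Defs "HOL-Algebra.Product_Groups"
begin

text \<open>Forgetting \<open>r\<close> in a pair \<open>(\<alpha>, r)\<close> is always injective on classes: if
  \<open>\<beta>(g) = a\<^sup>-\<^sup>1 \<alpha>(g) \<^sup>ga\<close> and \<open>t = \<pi>(a)\<^sup>-\<^sup>1 r\<close>, then applying \<open>\<pi>\<close> gives
  \<open>s \<^sup>gs\<^sup>-\<^sup>1 = t \<^sup>gt\<^sup>-\<^sup>1\<close>, which says exactly that \<open>t\<^sup>-\<^sup>1 s\<close> is \<open>G\<close>-invariant.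
  It is surjective as soon as every \<open>\<pi> \<circ> \<alpha>\<close> is a principal crossed homomorphism.\<close>

section \<open>Quotients by a pulled-back equivalence relation\<close>

lemma equiv_pullback:
  assumes r: "equiv A r" and f: "f ` B \<subseteq> A"
  shows "equiv B {(x, y). x \<in> B \<and> y \<in> B \<and> (f x, f y) \<in> r}"
proof (rule equivI)
  show "refl_on B {(x, y). x \<in> B \<and> y \<in> B \<and> (f x, f y) \<in> r}"
    using r f by (auto simp: refl_on_def equiv_def)
  show "sym {(x, y). x \<in> B \<and> y \<in> B \<and> (f x, f y) \<in> r}"
    using r by (auto simp: equiv_def sym_def)
  show "trans {(x, y). x \<in> B \<and> y \<in> B \<and> (f x, f y) \<in> r}"
    using r unfolding equiv_def trans_def by blast
qed auto

text \<open>Each \<open>s\<close>-class is the full preimage of one \<open>r\<close>-class, so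
  \<open>f\<close> is injective on classes; surjectivity of \<open>f\<close> onto \<open>A\<close>
  makes the induced map surjective. Taking the saturated image of a whole class avoids choosing
  representatives.\<close>

lemma
  assumes r: "equiv A r" and f: "f ` B = A"
    and s: "s = {(x, y). x \<in> B \<and> y \<in> B \<and> (f x, f y) \<in> r}"
  shows pullback_class: "x \<in> B \<Longrightarrow> r `` (f ` (s `` {x})) = r `` {f x}"
    and bij_betw_pullback_quotient: "bij_betw (\<lambda>X. r `` (f ` X)) (B // s) (A // r)"
proof -
  have cls: "r `` (f ` (s `` {x})) = r `` {f x}" if "x \<in> B" for x
  proof
    show "r `` (f ` (s `` {x})) \<subseteq> r `` {f x}"
      using r unfolding s equiv_def trans_def by blast
    have "x \<in> s `` {x}" using that r f by (auto simp: s equiv_def refl_on_def)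
    then show "r `` {f x} \<subseteq> r `` (f ` (s `` {x}))" by blast
  qed
  then show "x \<in> B \<Longrightarrow> r `` (f ` (s `` {x})) = r `` {f x}" .
  have es: "equiv B s" using equiv_pullback[OF r] f s by auto
  show "bij_betw (\<lambda>X. r `` (f ` X)) (B // s) (A // r)"
    unfolding bij_betw_def
  proof
    show "inj_on (\<lambda>X. r `` (f ` X)) (B // s)"
    proof (rule inj_onI)
      fix X Y assume X: "X \<in> B // s" and Y: "Y \<in> B // s" and eq: "r `` (f ` X) = r `` (f ` Y)"
      obtain x y where x: "x \<in> B" "X = s `` {x}" and y: "y \<in> B" "Y = s `` {y}"
        using X Y by (auto elim!: quotientE)
      have "(f x, f y) \<in> r"
        using eq x y cls f by (intro eq_equiv_class[OF _ r]) auto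
      then have "(x, y) \<in> s" using x y s by blast
      then show "X = Y" using equiv_class_eq[OF es] x y by simp
    qed
    have "B // s = (\<lambda>x. s `` {x}) ` B" and "A // r = (\<lambda>x. r `` {x}) ` f ` B"
      by (auto simp: quotient_def f)
    then show "(\<lambda>X. r `` (f ` X)) ` (B // s) = A // r"
      by (simp add: image_image cls cong: image_cong)
  qed
qed

text \<open>Here \<open>H\<close> is only a monoid record. It inherits the group axioms as a
  homomorphic image; this is how cohomology classes get their group structure from cocycles.\<close>

lemma (in group) group_of_surj_hom:
  assumes "h \<in> hom G H" and "h ` carrier G = carrier H" and "h \<one> = \<one>\<^bsub>H\<^esub>"
  shows "group H"
  using hom_imp_img_group[OF assms(1)] assms(2,3) by simp

section \<open>Algebra of crossed homomorphisms\<close>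

locale group_module = G: group G + M: group M
  for G and M (structure) +
  fixes act
  assumes act_hom: "g \<in> carrier G \<Longrightarrow> act g \<in> hom M M"
    and act_one: "a \<in> carrier M \<Longrightarrow> act \<one>\<^bsub>G\<^esub> a = a"
    and act_mult: "\<lbrakk>g \<in> carrier G; h \<in> carrier G; a \<in> carrier M\<rbrakk>
      \<Longrightarrow> act (g \<otimes>\<^bsub>G\<^esub> h) a = act g (act h a)"
begin

lemma act_closed [simp]: "\<lbrakk>g \<in> carrier G; a \<in> carrier M\<rbrakk> \<Longrightarrow> act g a \<in> carrier M"
  using act_hom by (auto simp: hom_def)

lemma act_distrib [simp]:
  "\<lbrakk>g \<in> carrier G; a \<in> carrier M; b \<in> carrier M\<rbrakk> \<Longrightarrow> act g (a \<otimes> b) = act g a \<otimes> act g b"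
  using act_hom by (auto simp: hom_def)

lemma group_hom_act: "g \<in> carrier G \<Longrightarrow> group_hom M M (act g)"
  by (rule group_hom.intro[OF M.is_group M.is_group])
    (simp add: group_hom_axioms_def act_hom)

lemma act_unit [simp]: "g \<in> carrier G \<Longrightarrow> act g \<one> = \<one>"
  using group_hom.hom_one[OF group_hom_act] .

lemma act_inv [simp]: "\<lbrakk>g \<in> carrier G; a \<in> carrier M\<rbrakk> \<Longrightarrow> act g (inv a) = inv (act g a)"
  using group_hom.hom_inv[OF group_hom_act] .

lemma crossed_hom_closed:
  "\<lbrakk>\<alpha> \<in> crossed_homs G TG M TM act; g \<in> carrier G\<rbrakk> \<Longrightarrow> \<alpha> g \<in> carrier M"
  by (auto simp: crossed_homs_def)

text \<open>The formula \<open>inv m \<otimes> \<alpha> g \<otimes> act g m\<close> defines a right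
  action of \<open>M\<close> on functions from \<open>G\<close> to \<open>M\<close>, and
  cohomologous means lying in one orbit. The witnesses are therefore \<open>\<one>\<close>,
  \<open>inv m\<close> and \<open>m \<otimes> n\<close>.\<close>

lemma equiv_cohomologous:
  "equiv (crossed_homs G TG M TM act) (cohomologous G TG M TM act)"
proof (rule equivI)
  show "cohomologous G TG M TM act \<subseteq>
      crossed_homs G TG M TM act \<times> crossed_homs G TG M TM act"
    by (auto simp: cohomologous_def)
  show "refl_on (crossed_homs G TG M TM act) (cohomologous G TG M TM act)"
    by (auto simp: refl_on_def cohomologous_def crossed_hom_closed intro!: bexI[of _ "\<one>"])
  show "sym (cohomologous G TG M TM act)"
  proof (rule symI)
    fix \<alpha> \<beta> assume "(\<alpha>, \<beta>) \<in> cohomologous G TG M TM act"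
    then obtain m where \<alpha>\<beta>: "\<alpha> \<in> crossed_homs G TG M TM act" "\<beta> \<in> crossed_homs G TG M TM act"
      and m: "m \<in> carrier M" "\<And>g. g \<in> carrier G \<Longrightarrow> \<beta> g = inv m \<otimes> \<alpha> g \<otimes> act g m"
      by (auto simp: cohomologous_def)
    have "\<alpha> g = inv (inv m) \<otimes> \<beta> g \<otimes> act g (inv m)" if g: "g \<in> carrier G" for g
      using g m crossed_hom_closed[OF \<alpha>\<beta>(1) g]
      \<comment> \<open>Bracketing to the right cancels \<open>act g m\<close> against its inverse
        at the end; bracketing to the left then cancels \<open>m\<close> at the front.\<close>
      by (simp add: M.m_assoc) (simp flip: M.m_assoc)
    then show "(\<beta>, \<alpha>) \<in> cohomologous G TG M TM act"
      using \<alpha>\<beta> m(1) by (auto simp: cohomologous_def intro!: bexI[of _ "inv m"])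
  qed
  show "trans (cohomologous G TG M TM act)"
  proof (rule transI)
    fix \<alpha> \<beta> \<gamma>
    assume "(\<alpha>, \<beta>) \<in> cohomologous G TG M TM act" "(\<beta>, \<gamma>) \<in> cohomologous G TG M TM act"
    then obtain m n where \<alpha>\<gamma>: "\<alpha> \<in> crossed_homs G TG M TM act" "\<gamma> \<in> crossed_homs G TG M TM act"
      and m: "m \<in> carrier M" "\<And>g. g \<in> carrier G \<Longrightarrow> \<beta> g = inv m \<otimes> \<alpha> g \<otimes> act g m"
      and n: "n \<in> carrier M" "\<And>g. g \<in> carrier G \<Longrightarrow> \<gamma> g = inv n \<otimes> \<beta> g \<otimes> act g n"
      by (auto simp: cohomologous_def)
    have "\<gamma> g = inv (m \<otimes> n) \<otimes> \<alpha> g \<otimes> act g (m \<otimes> n)" if g: "g \<in> carrier G" for g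
      using g m n crossed_hom_closed[OF \<alpha>\<gamma>(1) g]
      by (simp add: M.m_assoc M.inv_mult_group)
    then show "(\<alpha>, \<gamma>) \<in> cohomologous G TG M TM act"
      using \<alpha>\<gamma> m(1) n(1) by (auto simp: cohomologous_def intro!: bexI[of _ "m \<otimes> n"])
  qed
qed

text \<open>Constant maps are continuous. This element represents the base point of H^1.\<close>

lemma unit_crossed_hom:
  assumes "topspace TG = carrier G" and "topspace TM = carrier M"
  shows "(\<lambda>g\<in>carrier G. \<one>) \<in> crossed_homs G TG M TM act"
proof -
  have "continuous_map TG TM (\<lambda>g\<in>carrier G. \<one>)"
    by (rule continuous_map_eq[of _ _ "\<lambda>g. \<one>"]) (auto simp: assms)
  then show ?thesis by (auto simp: crossed_homs_def)
qed

text \<open>Multiply by \<open>act g s\<close> on the right and by \<open>inv t\<close> on the left.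
  Thus two elements define the same principal crossed homomorphism exactly when they differ by an
  invariant factor, which is where \<open>H0\<close> enters.\<close>

lemma principal_inv_iff:
  assumes s: "s \<in> carrier M" and t: "t \<in> carrier M" and g: "g \<in> carrier G"
  shows "s \<otimes> act g (inv s) = t \<otimes> act g (inv t) \<longleftrightarrow> act g (inv t \<otimes> s) = inv t \<otimes> s"
proof -
  have "s \<otimes> act g (inv s) = t \<otimes> act g (inv t) \<longleftrightarrow> s = t \<otimes> act g (inv t) \<otimes> act g s"
    using s t g by (metis M.inv_solve_right M.m_closed act_closed act_inv M.inv_closed)
  also have "\<dots> \<longleftrightarrow> inv t \<otimes> s = act g (inv t) \<otimes> act g s"
    using s t g by (simp add: M.m_assoc M.inv_solve_left')
  finally show ?thesis using s t g by auto
qed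

end

sublocale topological_module \<subseteq> group_module G A act
  by unfold_locales (auto intro: act_hom act_one act_mult)

text \<open>Keeps the unit and product of the quotient folded, so that simplification uses its group
  laws and the homomorphism rules of the projection instead of sets.\<close>

declare one_FactGroup [simp del] mult_FactGroup [simp del]

section \<open>The central quotient as coefficients, and forgetting the second component\<close>

context topological_module
begin

abbreviation "R \<equiv> central_quotient A"
abbreviation "TR \<equiv> central_quotient_topology A TA"
abbreviation "actR \<equiv> central_quotient_act A act"
abbreviation "\<pi> \<equiv> central_proj A"

lemma carrier_central_quotient: "carrier R = \<pi> ` carrier A"
  by (auto simp: FactGroup_def RCOSETS_def central_proj_def)

lemma central_proj_hom: "group_hom A R \<pi>"
  by (intro group_hom.intro A.is_group normal.factorgroup_is_group[OF A.center_normal])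
    (simp add: group_hom_axioms_def central_proj_def[abs_def]
      normal.r_coset_hom_Mod[OF A.center_normal])

sublocale proj: group_hom A R \<pi>
  by (rule central_proj_hom)

text \<open>Every coset is some \<open>\<pi> a\<close>, and the action moves inside
  \<open>\<pi>\<close>, so the laws descend from \<open>A\<close>. Working with
  \<open>group_module\<close> leaves only algebraic laws to check for \<open>R\<close>.\<close>

sublocale R: group_module G R actR
proof (intro group_module.intro group_module_axioms.intro G.is_group proj.H.is_group)
  fix g assume g: "g \<in> carrier G"
  show "actR g \<in> hom R R"
    using g by (auto simp: hom_def carrier_central_quotient central_quotient_act_proj
        simp flip: proj.hom_mult)
next
  fix a assume "a \<in> carrier R"
  then show "actR \<one>\<^bsub>G\<^esub> a = a"
    by (auto simp: carrier_central_quotient central_quotient_act_proj act_one)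
next
  fix g h a assume "g \<in> carrier G" "h \<in> carrier G" "a \<in> carrier R"
  then show "actR (g \<otimes>\<^bsub>G\<^esub> h) a = actR g (actR h a)"
    by (auto simp: carrier_central_quotient central_quotient_act_proj act_mult)
qed

lemma topspace_central_quotient: "topspace TR = carrier R"
  using A.quotient_map_central_proj
  by (simp add: quotient_map_def carrier_central_quotient A.topspace_eq)

text \<open>The projection is a continuous equivariant homomorphism. The restriction to
  \<open>carrier G\<close> makes the composite extensional.\<close>

lemma central_proj_crossed_hom:
  assumes \<alpha>: "\<alpha> \<in> crossed_homs G TG A TA act"
  shows "(\<lambda>g\<in>carrier G. \<pi> (\<alpha> g)) \<in> crossed_homs G TG R TR actR"
proof -
  have "continuous_map TG TR (\<pi> \<circ> \<alpha>)"
    using \<alpha> A.quotient_map_central_proj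
    by (auto simp: crossed_homs_def intro: continuous_map_compose quotient_imp_continuous_map)
  then have "continuous_map TG TR (\<lambda>g\<in>carrier G. \<pi> (\<alpha> g))"
    by (rule continuous_map_eq) (simp add: G.topspace_eq)
  moreover have "\<pi> (\<alpha> (g \<otimes>\<^bsub>G\<^esub> h)) = \<pi> (\<alpha> g) \<otimes>\<^bsub>R\<^esub> actR g (\<pi> (\<alpha> h))"
    if "g \<in> carrier G" "h \<in> carrier G" for g h
    using \<alpha> that crossed_hom_closed[OF \<alpha>]
    by (simp add: crossed_homs_def central_quotient_act_proj)
  ultimately show ?thesis
    using crossed_hom_closed[OF \<alpha>] by (auto simp: crossed_homs_def)
qed

text \<open>The coset condition on second components follows from the relation between the first
  ones, so the relation is the pullback of \<open>cohomologous\<close> along \<open>fst\<close> and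
  the general lemmas on pullbacks apply.\<close>

lemma Der_c_rel_eq:
  "Der_c_rel G TG A TA act = {(x, y). x \<in> Der_c G TG A TA act \<and> y \<in> Der_c G TG A TA act \<and>
    (fst x, fst y) \<in> cohomologous G TG A TA act}"
proof -
  have H0: "s \<in> (inv\<^bsub>R\<^esub> (\<pi> a) \<otimes>\<^bsub>R\<^esub> r) <#\<^bsub>R\<^esub> H0 G R actR"
    if x: "(\<alpha>, r) \<in> Der_c G TG A TA act" and y: "(\<beta>, s) \<in> Der_c G TG A TA act"
      and a: "a \<in> carrier A"
      and \<beta>: "\<And>g. g \<in> carrier G \<Longrightarrow> \<beta> g = inv\<^bsub>A\<^esub> a \<otimes>\<^bsub>A\<^esub> \<alpha> g \<otimes>\<^bsub>A\<^esub> act g a"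
    for \<alpha> r \<beta> s a
  proof -
    \<comment> \<open>The second component obtained by moving the pair \<open>(\<alpha>, r)\<close>
      along \<open>a\<close>; \<open>s\<close> has to agree with it up to \<open>H0\<close>.\<close>
    define t where "t = inv\<^bsub>R\<^esub> (\<pi> a) \<otimes>\<^bsub>R\<^esub> r"
    have \<alpha>: "\<alpha> \<in> crossed_homs G TG A TA act" and r: "r \<in> carrier R" and s: "s \<in> carrier R"
      and \<alpha>r: "\<And>g. g \<in> carrier G \<Longrightarrow> \<pi> (\<alpha> g) = r \<otimes>\<^bsub>R\<^esub> actR g (inv\<^bsub>R\<^esub> r)"
      and \<beta>s: "\<And>g. g \<in> carrier G \<Longrightarrow> \<pi> (\<beta> g) = s \<otimes>\<^bsub>R\<^esub> actR g (inv\<^bsub>R\<^esub> s)"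
      using x y by (auto simp: Der_c_def)
    have t: "t \<in> carrier R" using a r by (simp add: t_def)
    have "actR g (inv\<^bsub>R\<^esub> t \<otimes>\<^bsub>R\<^esub> s) = inv\<^bsub>R\<^esub> t \<otimes>\<^bsub>R\<^esub> s" if g: "g \<in> carrier G" for g
    proof -
      have "s \<otimes>\<^bsub>R\<^esub> actR g (inv\<^bsub>R\<^esub> s) = \<pi> (\<beta> g)" using \<beta>s[OF g] ..
      also have "\<dots> = inv\<^bsub>R\<^esub> (\<pi> a) \<otimes>\<^bsub>R\<^esub> \<pi> (\<alpha> g) \<otimes>\<^bsub>R\<^esub> actR g (\<pi> a)"
        using g a crossed_hom_closed[OF \<alpha> g] by (simp add: \<beta> central_quotient_act_proj)
      \<comment> \<open>Substitute the principal form of \<open>\<pi> (\<alpha> g)\<close>; the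
        inverse of \<open>t\<close> is the inverse of \<open>r\<close> times
        \<open>\<pi> a\<close>.\<close>
      also have "\<dots> = t \<otimes>\<^bsub>R\<^esub> actR g (inv\<^bsub>R\<^esub> t)"
        using g a r by (simp add: \<alpha>r t_def proj.H.m_assoc proj.H.inv_mult_group del: proj.hom_inv)
      finally show ?thesis using R.principal_inv_iff[OF s t g] by simp
    qed
    then have "inv\<^bsub>R\<^esub> t \<otimes>\<^bsub>R\<^esub> s \<in> H0 G R actR" using s t by (simp add: H0_def)
    moreover have "s = t \<otimes>\<^bsub>R\<^esub> (inv\<^bsub>R\<^esub> t \<otimes>\<^bsub>R\<^esub> s)"
      using s t by (simp flip: proj.H.m_assoc)
    ultimately show ?thesis unfolding t_def[symmetric] l_coset_def by blast
  qed
  have Z: "\<alpha> \<in> crossed_homs G TG A TA act" if "(\<alpha>, r) \<in> Der_c G TG A TA act" for \<alpha> r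
    using that by (simp add: Der_c_def)
  show ?thesis
    unfolding Der_c_rel_def cohomologous_def
  \<comment> \<open>The same \<open>a\<close> witnesses both relations. Only the coset condition
    needs an argument; the remaining goals are memberships given by \<open>Z\<close>.\<close>
  proof (intro Collect_cong, clarsimp, intro iffI conjI; elim conjE bexE)
    fix \<alpha> r \<beta> s a
    assume x: "(\<alpha>, r) \<in> Der_c G TG A TA act" and y: "(\<beta>, s) \<in> Der_c G TG A TA act"
      and a: "a \<in> carrier A"
      and \<beta>: "\<forall>g\<in>carrier G. \<beta> g = inv\<^bsub>A\<^esub> a \<otimes>\<^bsub>A\<^esub> \<alpha> g \<otimes>\<^bsub>A\<^esub> act g a"
    show "\<exists>a\<in>carrier A. (\<forall>g\<in>carrier G. \<beta> g = inv\<^bsub>A\<^esub> a \<otimes>\<^bsub>A\<^esub> \<alpha> g \<otimes>\<^bsub>A\<^esub> act g a) \<and>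
        s \<in> (inv\<^bsub>R\<^esub> (\<pi> a) \<otimes>\<^bsub>R\<^esub> r) <#\<^bsub>R\<^esub> H0 G R actR"
      using a \<beta> H0[OF x y a] by blast
  qed (use Z in blast)+
qed

lemma fst_Der_c_subset: "fst ` Der_c G TG A TA act \<subseteq> crossed_homs G TG A TA act"
  by (auto simp: Der_c_def)

lemma equiv_Der_c_rel: "equiv (Der_c G TG A TA act) (Der_c_rel G TG A TA act)"
  unfolding Der_c_rel_eq by (rule equiv_pullback[OF equiv_cohomologous fst_Der_c_subset])

abbreviation "forget \<equiv> \<lambda>X. cohomologous G TG A TA act `` (fst ` X)"

text \<open>The hypothesis says that every continuous crossed homomorphism has an admissible second
  component. It is established below in two situations: trivial H^1 of \<open>R\<close>, and
  commutative \<open>A\<close>.\<close>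

lemma bij_betw_forget:
  assumes "fst ` Der_c G TG A TA act = crossed_homs G TG A TA act"
  shows "bij_betw forget (barH1 G TG A TA act) (H1 G TG A TA act)"
  unfolding barH1_def H1_def
  by (rule bij_betw_pullback_quotient[OF equiv_cohomologous assms Der_c_rel_eq])

text \<open>With a single class available, the projection of \<open>\<alpha>\<close> is cohomologous
  to the unit crossed homomorphism, hence principal, and the element witnessing this yields the
  second component.\<close>

lemma fst_Der_c_if_H1_trivial:
  assumes "is_singleton (H1 G TG R TR actR)"
  shows "fst ` Der_c G TG A TA act = crossed_homs G TG A TA act"
proof (rule subset_antisym[OF fst_Der_c_subset] subsetI)+
  fix \<alpha> assume \<alpha>: "\<alpha> \<in> crossed_homs G TG A TA act"
  let ?u = "\<lambda>g\<in>carrier G. \<one>\<^bsub>R\<^esub>" and ?v = "\<lambda>g\<in>carrier G. \<pi> (\<alpha> g)"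
  have u: "?u \<in> crossed_homs G TG R TR actR"
    by (rule R.unit_crossed_hom[OF G.topspace_eq topspace_central_quotient])
  have v: "?v \<in> crossed_homs G TG R TR actR"
    by (rule central_proj_crossed_hom[OF \<alpha>])
  obtain C where "H1 G TG R TR actR = {C}" using assms by (rule is_singletonE)
  then have "cohomologous G TG R TR actR `` {?u} = cohomologous G TG R TR actR `` {?v}"
    using quotientI[OF u, of "cohomologous G TG R TR actR"]
      quotientI[OF v, of "cohomologous G TG R TR actR"]
    by (simp only: H1_def singleton_iff)
  then have "(?u, ?v) \<in> cohomologous G TG R TR actR"
    by (rule eq_equiv_class[OF _ R.equiv_cohomologous v])
  then obtain m where m: "m \<in> carrier R"
    and v_eq: "\<And>g. g \<in> carrier G \<Longrightarrow> \<pi> (\<alpha> g) = inv\<^bsub>R\<^esub> m \<otimes>\<^bsub>R\<^esub> actR g m"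
    by (auto simp: cohomologous_def)
  \<comment> \<open>The inverse appears because \<open>cohomologous\<close> puts it on the left
    factor, whereas \<open>Der_c\<close> puts it inside the action.\<close>
  then have "(\<alpha>, inv\<^bsub>R\<^esub> m) \<in> Der_c G TG A TA act"
    using \<alpha> by (simp add: Der_c_def)
  then show "\<alpha> \<in> fst ` Der_c G TG A TA act" by force
qed

end

section \<open>Abelian coefficients and the group isomorphism\<close>

locale abelian_topological_module = topological_module +
  assumes comm: "comm_group A"
begin

sublocale A: comm_group A
  by (rule comm)

abbreviation "Z \<equiv> crossed_homs G TG A TA act"
abbreviation "Zgroup \<equiv> product_group (carrier G) (\<lambda>_. A)\<lparr>carrier := Z\<rparr>"

text \<open>The crossed homomorphisms form a subgroup of the full power of \<open>A\<close> indexed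
  by \<open>carrier G\<close>: commutativity preserves the cocycle identity under pointwise products
  and inverses, and continuity of the operations of \<open>A\<close> preserves continuity.\<close>

lemma group_crossed_homs: "group Zgroup"
proof -
  let ?P = "product_group (carrier G) (\<lambda>_. A)"
  interpret P: group ?P by simp
  have "subgroup Z ?P"
  proof (rule P.subgroupI)
    show "Z \<subseteq> carrier ?P" by (auto simp: crossed_homs_def)
    show "Z \<noteq> {}" using unit_crossed_hom[OF G.topspace_eq A.topspace_eq] by blast
  next
    fix \<alpha> assume \<alpha>: "\<alpha> \<in> Z"
    have "continuous_map TG TA ((\<lambda>x. inv\<^bsub>A\<^esub> x) \<circ> \<alpha>)"
      using \<alpha> A.continuous_inv by (auto simp: crossed_homs_def intro: continuous_map_compose)
    then have "continuous_map TG TA (\<lambda>g\<in>carrier G. inv\<^bsub>A\<^esub> \<alpha> g)"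
      by (rule continuous_map_eq) (simp add: G.topspace_eq)
    then have "(\<lambda>g\<in>carrier G. inv\<^bsub>A\<^esub> \<alpha> g) \<in> Z"
      using \<alpha> crossed_hom_closed[OF \<alpha>] by (auto simp: crossed_homs_def A.inv_mult)
    moreover have "\<alpha> \<in> carrier G \<rightarrow>\<^sub>E carrier A" using \<alpha> by (simp add: crossed_homs_def)
    ultimately show "inv\<^bsub>?P\<^esub> \<alpha> \<in> Z" by (simp add: A.is_group)
  next
    fix \<alpha> \<beta> assume \<alpha>: "\<alpha> \<in> Z" and \<beta>: "\<beta> \<in> Z"
    have "continuous_map TG TA ((\<lambda>(x, y). x \<otimes>\<^bsub>A\<^esub> y) \<circ> (\<lambda>g. (\<alpha> g, \<beta> g)))"
      using \<alpha> \<beta> A.continuous_mult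
      by (auto simp: crossed_homs_def intro!: continuous_map_compose continuous_map_pairedI)
    then have "continuous_map TG TA (\<lambda>g\<in>carrier G. \<alpha> g \<otimes>\<^bsub>A\<^esub> \<beta> g)"
      by (rule continuous_map_eq) (simp add: G.topspace_eq)
    then show "\<alpha> \<otimes>\<^bsub>?P\<^esub> \<beta> \<in> Z"
      using \<alpha> \<beta> crossed_hom_closed[OF \<alpha>] crossed_hom_closed[OF \<beta>]
      by (auto simp: crossed_homs_def A.m_ac)
  qed
  then show ?thesis by (rule P.subgroup_imp_group)
qed

sublocale Z: group Zgroup
  by (rule group_crossed_homs)

lemma crossed_homs_mult_closed:
  "\<lbrakk>\<alpha> \<in> Z; \<beta> \<in> Z\<rbrakk> \<Longrightarrow> (\<lambda>g\<in>carrier G. \<alpha> g \<otimes>\<^bsub>A\<^esub> \<beta> g) \<in> Z"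
  using Z.m_closed[of \<alpha> \<beta>] by simp

text \<open>If \<open>m\<close> and \<open>n\<close> witness the two relations, then by
  commutativity \<open>m \<otimes> n\<close> witnesses the one between products.\<close>

lemma cohomologous_mult:
  assumes "(\<alpha>, \<alpha>') \<in> cohomologous G TG A TA act" and "(\<beta>, \<beta>') \<in> cohomologous G TG A TA act"
  shows "(\<lambda>g\<in>carrier G. \<alpha> g \<otimes>\<^bsub>A\<^esub> \<beta> g, \<lambda>g\<in>carrier G. \<alpha>' g \<otimes>\<^bsub>A\<^esub> \<beta>' g)
    \<in> cohomologous G TG A TA act"
proof -
  obtain m n where Z: "\<alpha> \<in> Z" "\<alpha>' \<in> Z" "\<beta> \<in> Z" "\<beta>' \<in> Z"
    and m: "m \<in> carrier A" "\<And>g. g \<in> carrier G \<Longrightarrow> \<alpha>' g = inv\<^bsub>A\<^esub> m \<otimes>\<^bsub>A\<^esub> \<alpha> g \<otimes>\<^bsub>A\<^esub> act g m"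
    and n: "n \<in> carrier A" "\<And>g. g \<in> carrier G \<Longrightarrow> \<beta>' g = inv\<^bsub>A\<^esub> n \<otimes>\<^bsub>A\<^esub> \<beta> g \<otimes>\<^bsub>A\<^esub> act g n"
    using assms by (auto simp: cohomologous_def)
  have "\<alpha>' g \<otimes>\<^bsub>A\<^esub> \<beta>' g =
      inv\<^bsub>A\<^esub> (m \<otimes>\<^bsub>A\<^esub> n) \<otimes>\<^bsub>A\<^esub> (\<alpha> g \<otimes>\<^bsub>A\<^esub> \<beta> g) \<otimes>\<^bsub>A\<^esub> act g (m \<otimes>\<^bsub>A\<^esub> n)"
    if g: "g \<in> carrier G" for g
    using g m n crossed_hom_closed[OF Z(1) g] crossed_hom_closed[OF Z(3) g]
    by (simp add: A.inv_mult A.m_ac)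
  then show ?thesis
    using Z m(1) n(1) crossed_homs_mult_closed
    by (auto simp: cohomologous_def intro!: bexI[of _ "m \<otimes>\<^bsub>A\<^esub> n"])
qed

text \<open>By congruence all representatives give the same class, so the union defining the product
  collapses to that class.\<close>

lemma H1_group_mult:
  assumes "\<alpha> \<in> Z" "\<beta> \<in> Z"
  shows "cohomologous G TG A TA act `` {\<alpha>} \<otimes>\<^bsub>H1_group G TG A TA act\<^esub>
      cohomologous G TG A TA act `` {\<beta>} =
    cohomologous G TG A TA act `` {\<lambda>g\<in>carrier G. \<alpha> g \<otimes>\<^bsub>A\<^esub> \<beta> g}"
proof -
  have "congruent2 (cohomologous G TG A TA act) (cohomologous G TG A TA act)
      (\<lambda>\<alpha> \<beta>. cohomologous G TG A TA act `` {\<lambda>g\<in>carrier G. \<alpha> g \<otimes>\<^bsub>A\<^esub> \<beta> g})"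
    by (intro congruent2I' equiv_class_eq[OF equiv_cohomologous] cohomologous_mult)
  from UN_equiv_class2[OF equiv_cohomologous equiv_cohomologous this assms]
  show ?thesis by (simp add: H1_group_def)
qed

text \<open>Taking classes is a multiplicative surjection from \<open>Zgroup\<close>.\<close>

lemma group_H1_group: "group (H1_group G TG A TA act)"
proof (rule Z.group_of_surj_hom[where h = "\<lambda>\<alpha>. cohomologous G TG A TA act `` {\<alpha>}"])
  show "(\<lambda>\<alpha>. cohomologous G TG A TA act `` {\<alpha>}) \<in> hom Zgroup (H1_group G TG A TA act)"
    by (rule homI) (simp_all add: H1_group_mult, simp add: H1_group_def H1_def quotientI)
qed (auto simp: H1_group_def H1_def quotient_def)

lemma central_proj_trivial: "a \<in> carrier A \<Longrightarrow> \<pi> a = \<one>\<^bsub>R\<^esub>"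
  using A.coset_join2[OF _ A.center_subgroup]
  by (simp add: central_proj_def center_def A.m_comm FactGroup_def)

text \<open>The center is all of \<open>A\<close>, so \<open>R\<close> has one element and both
  sides of the compatibility condition are its unit.\<close>

lemma Der_c_eq: "Der_c G TG A TA act = Z \<times> {\<one>\<^bsub>R\<^esub>}"
proof -
  have "carrier R = {\<one>\<^bsub>R\<^esub>}"
    using central_proj_trivial by (auto simp: carrier_central_quotient image_iff)
  then show ?thesis
    by (auto simp: Der_c_def central_proj_trivial crossed_hom_closed)
qed

lemma central_conj_trivial: "b \<in> carrier A \<Longrightarrow> central_conj A \<one>\<^bsub>R\<^esub> b = b"
  using A.central_conj_proj[of "\<one>\<^bsub>A\<^esub>" b] by simp

text \<open>Conjugation by the unit is trivial, and commutativity reverses the order of the factors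
  in \<open>Der_c_mult\<close>.\<close>

lemma Der_c_mult_eq:
  assumes "\<alpha> \<in> Z" "\<beta> \<in> Z"
  shows "Der_c_mult G A (\<alpha>, \<one>\<^bsub>R\<^esub>) (\<beta>, \<one>\<^bsub>R\<^esub>) =
    (\<lambda>g\<in>carrier G. \<alpha> g \<otimes>\<^bsub>A\<^esub> \<beta> g, \<one>\<^bsub>R\<^esub>)"
  using assms
  by (auto simp: Der_c_mult_def central_conj_trivial crossed_hom_closed A.m_comm
      intro!: restrict_ext)

lemma barH1_group_mult:
  assumes "\<alpha> \<in> Z" "\<beta> \<in> Z"
  shows "Der_c_rel G TG A TA act `` {(\<alpha>, \<one>\<^bsub>R\<^esub>)} \<otimes>\<^bsub>barH1_group G TG A TA act\<^esub>
      Der_c_rel G TG A TA act `` {(\<beta>, \<one>\<^bsub>R\<^esub>)} =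
    Der_c_rel G TG A TA act `` {(\<lambda>g\<in>carrier G. \<alpha> g \<otimes>\<^bsub>A\<^esub> \<beta> g, \<one>\<^bsub>R\<^esub>)}"
proof -
  have "congruent2 (Der_c_rel G TG A TA act) (Der_c_rel G TG A TA act)
      (\<lambda>x y. Der_c_rel G TG A TA act `` {Der_c_mult G A x y})"
    by (intro congruent2I' equiv_class_eq[OF equiv_Der_c_rel])
      (auto simp: Der_c_rel_eq Der_c_eq Der_c_mult_eq crossed_homs_mult_closed cohomologous_mult)
  from UN_equiv_class2[OF equiv_Der_c_rel equiv_Der_c_rel this]
  show ?thesis using assms by (simp add: barH1_group_def Der_c_eq Der_c_mult_eq)
qed

lemma group_barH1_group: "group (barH1_group G TG A TA act)"
proof (rule Z.group_of_surj_hom[where h = "\<lambda>\<alpha>. Der_c_rel G TG A TA act `` {(\<alpha>, \<one>\<^bsub>R\<^esub>)}"])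
  show "(\<lambda>\<alpha>. Der_c_rel G TG A TA act `` {(\<alpha>, \<one>\<^bsub>R\<^esub>)}) \<in> hom Zgroup (barH1_group G TG A TA act)"
    by (rule homI)
      (simp_all add: barH1_group_mult, simp add: barH1_group_def barH1_def Der_c_eq quotientI)
qed (auto simp: barH1_group_def barH1_def Der_c_eq quotient_def)

lemma fst_Der_c: "fst ` Der_c G TG A TA act = Z"
  by (simp add: Der_c_eq)

lemma forget_class:
  "\<alpha> \<in> Z \<Longrightarrow> forget (Der_c_rel G TG A TA act `` {(\<alpha>, \<one>\<^bsub>R\<^esub>)}) =
    cohomologous G TG A TA act `` {\<alpha>}"
  using pullback_class[OF equiv_cohomologous fst_Der_c Der_c_rel_eq, of "(\<alpha>, \<one>\<^bsub>R\<^esub>)"]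
  by (simp add: Der_c_eq)

text \<open>Every class is represented by a pair with unit second component, and on such
  representatives both products are pointwise multiplication of crossed homomorphisms.\<close>

lemma forget_iso: "forget \<in> iso (barH1_group G TG A TA act) (H1_group G TG A TA act)"
proof (rule isoI)
  show bij: "bij_betw forget (carrier (barH1_group G TG A TA act))
      (carrier (H1_group G TG A TA act))"
    using bij_betw_forget[OF fst_Der_c] by (simp add: barH1_group_def H1_group_def)
  show "forget \<in> hom (barH1_group G TG A TA act) (H1_group G TG A TA act)"
  proof (rule homI)
    fix X Y
    assume "X \<in> carrier (barH1_group G TG A TA act)" "Y \<in> carrier (barH1_group G TG A TA act)"
    then obtain \<alpha> \<beta> where "\<alpha> \<in> Z" "\<beta> \<in> Z"
      and "X = Der_c_rel G TG A TA act `` {(\<alpha>, \<one>\<^bsub>R\<^esub>)}"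
        "Y = Der_c_rel G TG A TA act `` {(\<beta>, \<one>\<^bsub>R\<^esub>)}"
      by (auto simp: barH1_group_def barH1_def Der_c_eq quotient_def)
    then show "forget (X \<otimes>\<^bsub>barH1_group G TG A TA act\<^esub> Y) =
        forget X \<otimes>\<^bsub>H1_group G TG A TA act\<^esub> forget Y"
      by (simp only: barH1_group_mult H1_group_mult forget_class crossed_homs_mult_closed)
  qed (use bij in \<open>auto simp: bij_betw_def\<close>)
qed

end

theorem corollary2p15:
  fixes G :: "'g monoid" and TG :: "'g topology"
    and A :: "'a monoid" and TA :: "'a topology"
    and act :: "'g \<Rightarrow> 'a \<Rightarrow> 'a"
  assumes "topological_module G TG A TA act"
  shows "(is_singleton (H1 G TG (central_quotient A) (central_quotient_topology A TA)
            (central_quotient_act A act)) \<longrightarrow>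
          (\<exists>f. bij_betw f (barH1 G TG A TA act) (H1 G TG A TA act))) \<and>
         (comm_group A \<longrightarrow>
          group (barH1_group G TG A TA act) \<and> group (H1_group G TG A TA act) \<and>
          barH1_group G TG A TA act \<cong> H1_group G TG A TA act)"
proof -
  interpret topological_module G TG A TA act by (rule assms)
  have "group (barH1_group G TG A TA act) \<and> group (H1_group G TG A TA act) \<and>
      barH1_group G TG A TA act \<cong> H1_group G TG A TA act" if "comm_group A"
  proof -
    interpret abelian_topological_module G TG A TA act
      by (intro abelian_topological_module.intro abelian_topological_module_axioms.intro
          topological_module_axioms that)
    show ?thesis
      using group_barH1_group group_H1_group forget_iso by (auto intro: is_isoI)
  qed
  \<comment> \<open>The bijection in the first conjunct is \<open>forget\<close>.\<close>
  then show ?thesis using bij_betw_forget[OF fst_Der_c_if_H1_trivial] by blast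
qed

end
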